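(* Let $c:\mathbb R^{d_x}\times\mathbb R^{d_y}\to[0,\infty)$ be lower semicontinuous and let $\mu\in\mathcal P_2(\mathbb R^{d_x})$, $\nu\in\mathcal P_2(\mathbb R^{d_y})$ satisfy $\iint c(x,y)\,\mathrm d\mu(x)\,\mathrm d\nu(y)<\infty$. Assume that for every $\Lambda>0$ the functional $E(\cdot,\Lambda)$ has a unique minimizer $b[\Lambda]$ over $\mathcal P_2(\mathbb R^{d_x}\times\mathbb R^{d_y})$, and set $E_d(\Lambda):=E(b[\Lambda],\Lambda)$ for $\Lambda>0$. Then for every $\Lambda>0$, $$\frac{\mathrm d}{\mathrm d\Lambda}E_d(\Lambda)=\partial_\Lambda E(\rho,\Lambda)\big|_{\rho=b[\Lambda]}.$$ As a result, the best-response dynamics $\frac{\mathrm d}{\mathrm dt}\Lambda(t)=\partial_\Lambda E(b[\Lambda],\Lambda)$ with $b[\Lambda]=\operatorname{argmin}_{\rho\in\mathcal P_2}E(\rho,\Lambda)$ (the derivative being taken through the best response, i.e. of $\Lambda\mapsto E(b[\Lambda],\Lambda)$) are given by $$\dot\Lambda=V(\Lambda),\qquad V(\Lambda):=\mathrm{KL}(b_1[\Lambda]\,|\,\mu)+\mathrm{KL}(b_2[\Lambda]\,|\,\nu),$$ where $b_1[\Lambda],b_2[\Lambda]$ are the marginals of $b[\Lambda]$.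
   Context: $\mathcal P_2(\mathbb R^d)$ is the space of Borel probability measures on $\mathbb R^d$ with finite second moment. For $\rho\in\mathcal P_2(\mathbb R^{d_x}\times\mathbb R^{d_y})$ with marginals $\rho_1,\rho_2$, $$E(\rho,\Lambda)=\iint c\,\mathrm d\rho+\Lambda\,\mathrm{KL}(\rho_1\,|\,\mu)+\Lambda\,\mathrm{KL}(\rho_2\,|\,\nu),$$ with $\mathrm{KL}(\alpha\,|\,\beta)=\int\log(\mathrm d\alpha/\mathrm d\beta)\,\mathrm d\alpha$ if $\alpha\ll\beta$ and $+\infty$ otherwise. $\partial_\Lambda E(\rho,\Lambda)$ is the partial derivative in $\Lambda$ with $\rho$ held fixed. *)

theory Defs
  imports "HOL-Probability.Probability"
begin

definition lower_semicontinuous :: "('a::topological_space \<Rightarrow> real) \<Rightarrow> bool" where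
  "lower_semicontinuous f \<longleftrightarrow> (\<forall>x. ereal (f x) \<le> Liminf (at x) (\<lambda>y. ereal (f y)))"

definition P2 :: "'a::euclidean_space measure set" where
  "P2 = {M. prob_space M \<and> sets M = sets borel \<and> integrable M (\<lambda>x. (norm x)\<^sup>2)}"

text \<open>
  The Lebesgue integral with values in the extended reals.  It is meaningful as soon as one of the
  two parts is finite.  The Bochner integral cannot be used in its place, as it is 0 (and not
  \<open>\<infinity>\<close>) on functions that are not integrable.
\<close>
definition ext_integral :: "'a measure \<Rightarrow> ('a \<Rightarrow> real) \<Rightarrow> ereal" where
  "ext_integral M f =
     enn2ereal (\<integral>\<^sup>+x. ennreal (f x) \<partial>M) - enn2ereal (\<integral>\<^sup>+x. ennreal (- f x) \<partial>M)"

text \<open>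
  \<open>RN_deriv \<beta> \<alpha>\<close> is the density of \<open>\<alpha>\<close> with respect to \<open>\<beta>\<close>, and \<open>absolutely_continuous \<beta> \<alpha>\<close> says
  that \<open>\<alpha>\<close> is absolutely continuous with respect to \<open>\<beta>\<close>.  For probability measures the negative
  part of the logarithm is always integrable, so that the integral below is well defined.  The
  constant \<open>KL_divergence\<close> of \<open>HOL-Probability\<close> agrees with \<open>KL\<close> only if the logarithm is integrable.
\<close>
definition KL :: "'a measure \<Rightarrow> 'a measure \<Rightarrow> ereal" where
  "KL \<alpha> \<beta> = (if absolutely_continuous \<beta> \<alpha>
              then ext_integral \<alpha> (\<lambda>x. ln (enn2real (RN_deriv \<beta> \<alpha> x)))
              else \<infinity>)"

lemma KL_eq_KL_divergence:
  assumes "absolutely_continuous \<beta> \<alpha>"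
    and int: "integrable \<alpha> (\<lambda>x. ln (enn2real (RN_deriv \<beta> \<alpha> x)))"
  shows "KL \<alpha> \<beta> = ereal (KL_divergence (exp 1) \<beta> \<alpha>)"
proof -
  let ?f = "\<lambda>x. ln (enn2real (RN_deriv \<beta> \<alpha> x))"
  have "(\<integral>\<^sup>+x. ennreal (?f x) \<partial>\<alpha>) < \<infinity>"
    using integrableD(2)[OF int] by (simp add: less_top)
  moreover have "(\<integral>\<^sup>+x. ennreal (- ?f x) \<partial>\<alpha>) < \<infinity>"
    using integrableD(3)[OF int] by (simp add: less_top)
  ultimately have "ext_integral \<alpha> ?f = ereal (\<integral>x. ?f x \<partial>\<alpha>)"
    unfolding ext_integral_def real_lebesgue_integral_def[OF int]
    by (cases "\<integral>\<^sup>+x. ennreal (?f x) \<partial>\<alpha>"; cases "\<integral>\<^sup>+x. ennreal (- ?f x) \<partial>\<alpha>") 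
       (auto simp: enn2ereal_ennreal)
  then show ?thesis
    using assms by (simp add: KL_def KL_divergence_def entropy_density_def comp_def log_def)
qed

abbreviation marginal1 :: "('a::euclidean_space \<times> 'b::euclidean_space) measure \<Rightarrow> 'a measure" where
  "marginal1 \<rho> \<equiv> distr \<rho> borel fst"

abbreviation marginal2 :: "('a::euclidean_space \<times> 'b::euclidean_space) measure \<Rightarrow> 'b measure" where
  "marginal2 \<rho> \<equiv> distr \<rho> borel snd"

text \<open>The cost \<open>c\<close> is nonnegative, so that its integral is a nonnegative extended number.\<close>
definition energy ::
  "('a::euclidean_space \<times> 'b::euclidean_space \<Rightarrow> real) \<Rightarrow> 'a measure \<Rightarrow> 'b measure \<Rightarrow>
   ('a \<times> 'b) measure \<Rightarrow> real \<Rightarrow> ereal" where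
  "energy c \<mu> \<nu> \<rho> \<Lambda> =
     enn2ereal (\<integral>\<^sup>+z. ennreal (c z) \<partial>\<rho>)
     + ereal \<Lambda> * KL (marginal1 \<rho>) \<mu> + ereal \<Lambda> * KL (marginal2 \<rho>) \<nu>"

definition is_best_response ::
  "('a::euclidean_space \<times> 'b::euclidean_space \<Rightarrow> real) \<Rightarrow> 'a measure \<Rightarrow> 'b measure \<Rightarrow> real \<Rightarrow>
   ('a \<times> 'b) measure \<Rightarrow> bool" where
  "is_best_response c \<mu> \<nu> \<Lambda> \<rho> \<longleftrightarrow> is_arg_min (\<lambda>\<sigma>. energy c \<mu> \<nu> \<sigma> \<Lambda>) (\<lambda>\<sigma>. \<sigma> \<in> P2) \<rho>"

definition best_response ::
  "('a::euclidean_space \<times> 'b::euclidean_space \<Rightarrow> real) \<Rightarrow> 'a measure \<Rightarrow> 'b measure \<Rightarrow> real \<Rightarrow>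
   ('a \<times> 'b) measure" where
  "best_response c \<mu> \<nu> \<Lambda> = (THE \<rho>. is_best_response c \<mu> \<nu> \<Lambda> \<rho>)"

text \<open>
  Derivatives in \<open>\<Lambda>\<close> are those of the real-valued functions obtained with \<open>real_of_ereal\<close>, which is
  faithful only where the extended value is finite.
\<close>
definition partial_energy ::
  "('a::euclidean_space \<times> 'b::euclidean_space \<Rightarrow> real) \<Rightarrow> 'a measure \<Rightarrow> 'b measure \<Rightarrow>
   ('a \<times> 'b) measure \<Rightarrow> real \<Rightarrow> real" where
  "partial_energy c \<mu> \<nu> \<rho> \<Lambda> = deriv (\<lambda>L. real_of_ereal (energy c \<mu> \<nu> \<rho> L)) \<Lambda>"

definition Ed ::
  "('a::euclidean_space \<times> 'b::euclidean_space \<Rightarrow> real) \<Rightarrow> 'a measure \<Rightarrow> 'b measure \<Rightarrow> real \<Rightarrow> real" where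
  "Ed c \<mu> \<nu> \<Lambda> = real_of_ereal (energy c \<mu> \<nu> (best_response c \<mu> \<nu> \<Lambda>) \<Lambda>)"

definition velocity ::
  "('a::euclidean_space \<times> 'b::euclidean_space \<Rightarrow> real) \<Rightarrow> 'a measure \<Rightarrow> 'b measure \<Rightarrow> real \<Rightarrow> ereal" where
  "velocity c \<mu> \<nu> \<Lambda> = KL (marginal1 (best_response c \<mu> \<nu> \<Lambda>)) \<mu> + KL (marginal2 (best_response c \<mu> \<nu> \<Lambda>)) \<nu>"

text \<open>
  \<open>\<Lambda>\<close> solves \<open>\<Lambda>' = F \<Lambda>\<close> on the time interval \<open>T\<close>, with values in the domain \<open>\<Lambda> > 0\<close>.
\<close>
definition solves_on :: "(real \<Rightarrow> real) \<Rightarrow> real set \<Rightarrow> (real \<Rightarrow> real) \<Rightarrow> bool" where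
  "solves_on F T \<Lambda> \<longleftrightarrow>
     (\<forall>t\<in>T. 0 < \<Lambda> t \<and> (\<Lambda> has_real_derivative F (\<Lambda> t)) (at t within T))"

end

theory Submission
  imports Defs "HOL-Real_Asymp.Real_Asymp"
begin

text \<open>
  Write the energy as \<open>C(\<rho>) + \<Lambda> K(\<rho>)\<close>, with transport cost \<open>C\<close> and penalty \<open>K\<close>, the sum of
  the two relative entropies.  For fixed \<open>\<rho>\<close> it is affine in \<open>\<Lambda>\<close> with slope \<open>K(\<rho>)\<close>, so the
  claim is that the minimal energy is differentiable at \<open>\<Lambda>\<close> with derivative \<open>K(b[\<Lambda>])\<close>.  Comparing
  the minimisers for two weights with each other traps the difference quotient between \<open>K(b[\<Lambda>])\<close>
  and \<open>K(b[L])\<close> (\<open>envelope_derivative\<close>).  All the work lies in the continuity of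
  \<open>\<Lambda> \<mapsto> K(b[\<Lambda>])\<close> (\<open>penalty_minimiser_continuous\<close>), which says that the infimum of affine
  functions has no kink.

  Finiteness is easy: \<open>\<mu> \<otimes> \<nu>\<close> has finite cost and no penalty, and all terms of the energy are
  nonnegative.  Continuity is proved without weak compactness, which would have to cope with limits that
  leave the space of measures with finite second moment.  Let \<open>\<rho>\<close> and \<open>\<sigma>\<close> be the
  minimisers for nearby weights \<open>L1 < L2\<close>.  Minimality gives \<open>K(\<sigma>) \<le> K(\<rho>)\<close>, and only
  a drop of \<open>K\<close> has to be excluded.

  The energy of \<open>\<rho>\<close> for the weight \<open>L2\<close> is nearly minimal.  As the cost is affine, strict
  convexity of \<open>x ln x\<close>, tested at the midpoint of \<open>\<rho>\<close> and \<open>\<sigma>\<close>, shows that \<open>\<rho>\<close> has little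
  mass where a marginal density of \<open>\<rho>\<close> exceeds \<open>q > 1\<close> times the one of \<open>\<sigma>\<close>
  (\<open>KL_midpoint\<close>).  This alone does not bring the entropies together, because a set of tiny
  mass can carry much entropy.  But that set can be cut off: \<open>\<rho>\<close> conditioned on its complement
  costs little more than \<open>\<rho>\<close>, and its marginals are dominated by \<open>q\<^sup>2\<close> times those of
  \<open>\<sigma>\<close>.  A measure dominated by a multiple close to 1 of another has hardly more
  entropy than the latter (\<open>KL_dominated\<close>).  So there is a competitor with nearly the cost of \<open>\<rho>\<close>
  and nearly the penalty of \<open>\<sigma>\<close>.  As \<open>\<sigma>\<close> is minimal, \<open>C(\<sigma>)\<close> cannot be much larger than
  \<open>C(\<rho>)\<close>, and as \<open>\<rho>\<close> is minimal for \<open>L1\<close>, \<open>K(\<rho>)\<close> cannot be much larger than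
  \<open>K(\<sigma>)\<close> (\<open>penalty_drop_bound\<close>).
\<close>

section \<open>Convexity of the entropy density\<close>

definition xlnx :: "real \<Rightarrow> real" where "xlnx x = x * ln x"

lemma measurable_xlnx [measurable]: "xlnx \<in> borel_measurable borel"
  unfolding xlnx_def by measurable

lemma xlnx_tangent:
  assumes "0 \<le> x" "0 < a"
  shows "xlnx a + (1 + ln a) * (x - a) \<le> xlnx x"
proof (cases "x = 0")
  case True
  then show ?thesis using assms by (simp add: xlnx_def algebra_simps)
next
  case False
  then have x: "0 < x" using assms by simp
  have "ln (a / x) \<le> a / x - 1"
    using x assms by (intro ln_le_minus_one) simp
  then have "x * (ln a - ln x) \<le> x * (a / x - 1)"
    using x assms by (intro mult_left_mono) (auto simp: ln_div)
  then show ?thesis using x by (simp add: xlnx_def algebra_simps)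
qed

lemma xlnx_ge: "0 \<le> x \<Longrightarrow> x - 1 \<le> xlnx x"
  using xlnx_tangent[of x 1] by (simp add: xlnx_def)

text \<open>
  Both summands only gain when the logarithm is evaluated at the larger argument \<open>x + y\<close>.
\<close>
lemma xlnx_superadditive:
  assumes "0 \<le> x" "0 \<le> y"
  shows "xlnx x + xlnx y \<le> xlnx (x + y)"
proof -
  have "xlnx x \<le> x * ln (x + y)" if "0 \<le> x" "0 \<le> y" for x y :: real
    using that by (cases "x = 0") (auto simp: xlnx_def intro!: mult_left_mono)
  from this[OF assms] this[OF assms(2,1)] show ?thesis
    by (simp add: xlnx_def algebra_simps)
qed

lemma xlnx_mult: "0 < a \<Longrightarrow> 0 \<le> x \<Longrightarrow> xlnx (a * x) = a * xlnx x + xlnx a * x"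
  by (cases "x = 0") (auto simp: xlnx_def ln_mult algebra_simps)

text \<open>
  The tangent line inequality with a quantitative remainder.  It comes from \<open>ln s \<le> s - 1\<close> at
  \<open>s = sqrt (m / x)\<close> instead of \<open>m / x\<close>; the remainder is the integrand of the squared Hellinger
  distance.
\<close>
lemma xlnx_Hellinger:
  assumes "0 \<le> x" "0 < m"
  shows "xlnx m + (1 + ln m) * (x - m) + (sqrt x - sqrt m)\<^sup>2 \<le> xlnx x"
proof (cases "x = 0")
  case True
  then show ?thesis using assms by (simp add: xlnx_def algebra_simps)
next
  case False
  then have x: "0 < x" using assms by simp
  have "ln (sqrt (m / x)) \<le> sqrt (m / x) - 1"
    using x assms by (intro ln_le_minus_one) simp
  then have "(ln m - ln x) / 2 \<le> sqrt m / sqrt x - 1"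
    using x assms by (simp add: ln_sqrt ln_div real_sqrt_divide diff_divide_distrib)
  then have "2 * x * ((ln m - ln x) / 2) \<le> 2 * x * (sqrt m / sqrt x - 1)"
    using x by (intro mult_left_mono) auto
  also have "\<dots> = 2 * (sqrt x * sqrt m) - 2 * x"
  proof -
    have "x * (sqrt m / sqrt x) = (sqrt x * sqrt x) * (sqrt m / sqrt x)" using x by simp
    also have "\<dots> = sqrt x * sqrt m" using x by (simp add: field_simps)
    finally show ?thesis by (simp add: right_diff_distrib)
  qed
  finally have "x * (ln m - ln x) \<le> 2 * (sqrt x * sqrt m) - 2 * x" by simp
  then show ?thesis using x assms by (simp add: xlnx_def algebra_simps power2_eq_square)
qed

text \<open>
  If \<open>x > q y\<close>, then the midpoint of \<open>x\<close> and \<open>y\<close> is at most the fraction \<open>(1 + 1/q) / 2\<close> of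
  \<open>x\<close>, and this is half of what remains of the Hellinger term per unit of \<open>x\<close>.
\<close>
definition gap_rate :: "real \<Rightarrow> real" where
  "gap_rate q = (1 - sqrt ((1 + 1 / q) / 2))\<^sup>2 / 2"

lemma gap_rate_pos: "1 < q \<Longrightarrow> 0 < gap_rate q"
proof -
  assume "1 < q"
  then have "sqrt ((1 + 1 / q) / 2) < sqrt 1"
    by (intro real_sqrt_less_mono) simp
  then have "0 < 1 - sqrt ((1 + 1 / q) / 2)" by (simp only: real_sqrt_one diff_gt_0_iff_gt)
  then show ?thesis unfolding gap_rate_def by (intro divide_pos_pos zero_less_power) simp_all
qed

lemma xlnx_midpoint:
  assumes "0 \<le> x" "0 \<le> y"
  shows "xlnx ((x + y) / 2) \<le> (xlnx x + xlnx y) / 2"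
proof (cases "x + y = 0")
  case True
  then have "x = 0" "y = 0" using assms by linarith+
  then show ?thesis by (simp add: xlnx_def)
next
  case False
  then have m: "0 < (x + y) / 2" using assms by (simp add: less_le)
  have "2 * xlnx ((x + y) / 2) = xlnx ((x + y) / 2) + (1 + ln ((x + y) / 2)) * (x - (x + y) / 2)
      + (xlnx ((x + y) / 2) + (1 + ln ((x + y) / 2)) * (y - (x + y) / 2))"
    by (simp add: algebra_simps)
  also have "\<dots> \<le> xlnx x + xlnx y"
    using m assms by (intro add_mono xlnx_tangent)
  finally show ?thesis by simp
qed

text \<open>
  Strict convexity in a scale-invariant form: where one density exceeds \<open>q\<close> times the other,
  passing to the midpoint gains at least a fixed fraction of the larger one.
\<close>
lemma xlnx_midpoint_gap:
  assumes "1 < q" "0 \<le> y" "q * y < x"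
  shows "xlnx ((x + y) / 2) + gap_rate q * x \<le> (xlnx x + xlnx y) / 2"
proof -
  define m where "m = (x + y) / 2"
  have x: "0 < x" using assms by (smt (verit) mult_nonneg_nonneg)
  have m: "0 < m" using x assms by (simp add: m_def)
  have "2 * m \<le> x * (1 + 1 / q)" using assms by (simp add: m_def field_simps)
  then have "sqrt m \<le> sqrt (x * ((1 + 1 / q) / 2))" by (intro real_sqrt_le_mono) simp
  also have "\<dots> = sqrt x * sqrt ((1 + 1 / q) / 2)" by (simp only: real_sqrt_mult)
  finally have "sqrt x * (1 - sqrt ((1 + 1 / q) / 2)) \<le> sqrt x - sqrt m"
    by (simp add: algebra_simps)
  moreover have "sqrt ((1 + 1 / q) / 2) \<le> 1" using assms by (simp add: field_simps)
  ultimately have "(sqrt x * (1 - sqrt ((1 + 1 / q) / 2)))\<^sup>2 \<le> (sqrt x - sqrt m)\<^sup>2"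
    using x by (intro power_mono) auto
  then have "2 * gap_rate q * x \<le> (sqrt x - sqrt m)\<^sup>2"
    using x by (simp add: gap_rate_def power_mult_distrib mult.commute)
  moreover have "xlnx m + (1 + ln m) * (x - m) + (sqrt x - sqrt m)\<^sup>2 \<le> xlnx x"
    using x m by (intro xlnx_Hellinger) auto
  moreover have "xlnx m + (1 + ln m) * (y - m) \<le> xlnx y"
    using assms m by (intro xlnx_tangent) auto
  moreover have "(1 + ln m) * (x - m) + (1 + ln m) * (y - m) = 0"
    by (simp add: m_def algebra_simps)
  ultimately have "2 * (xlnx m + gap_rate q * x) \<le> xlnx x + xlnx y" by argo
  then show ?thesis by (simp add: m_def)
qed

section \<open>Relative entropy of mixtures and of dominated measures\<close>

text \<open>
  The negative part of \<open>x ln x\<close> is bounded, hence integrable against a probability measure.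
  This decides the case distinction: if \<open>xlnx (f x)\<close> is not integrable, its positive part has integral
  \<open>\<infinity>\<close>.
\<close>
lemma KL_density_eq_integral:
  assumes "prob_space \<mu>" and [measurable]: "f \<in> borel_measurable \<mu>" and f0: "\<And>x. 0 \<le> f x"
  shows "KL (density \<mu> (\<lambda>x. ennreal (f x))) \<mu> =
    (if integrable \<mu> (\<lambda>x. xlnx (f x)) then ereal (\<integral>x. xlnx (f x) \<partial>\<mu>) else \<infinity>)"
proof -
  interpret prob_space \<mu> by fact
  let ?\<alpha> = "density \<mu> (\<lambda>x. ennreal (f x))"
  let ?g = "\<lambda>x. enn2real (RN_deriv \<mu> ?\<alpha> x)"
  have ac: "absolutely_continuous \<mu> ?\<alpha>" by (intro absolutely_continuousI_density) simp
  have "AE x in \<mu>. ennreal (f x) = RN_deriv \<mu> ?\<alpha> x"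
    by (intro RN_deriv_unique) auto
  then have g: "AE x in \<mu>. ?g x = f x"
    by eventually_elim (metis enn2real_ennreal f0)
  have pos: "(\<integral>\<^sup>+x. ennreal (ln (?g x)) \<partial>?\<alpha>) = (\<integral>\<^sup>+x. ennreal (xlnx (f x)) \<partial>\<mu>)"
    using g f0 by (subst nn_integral_density)
      (auto intro!: nn_integral_cong_AE elim!: eventually_mono simp: ennreal_mult'[symmetric] xlnx_def)
  have neg: "(\<integral>\<^sup>+x. ennreal (- ln (?g x)) \<partial>?\<alpha>) = (\<integral>\<^sup>+x. ennreal (- xlnx (f x)) \<partial>\<mu>)"
    using g f0 by (subst nn_integral_density)
      (auto intro!: nn_integral_cong_AE elim!: eventually_mono simp: ennreal_mult'[symmetric] xlnx_def)
  have "(\<integral>\<^sup>+x. ennreal (- xlnx (f x)) \<partial>\<mu>) \<le> (\<integral>\<^sup>+x. 1 \<partial>\<mu>)"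
  proof (intro nn_integral_mono)
    fix x
    have "- xlnx (f x) \<le> 1" using xlnx_ge[OF f0[of x]] f0[of x] by linarith
    then show "ennreal (- xlnx (f x)) \<le> 1" by (simp add: ennreal_le_1)
  qed
  then have fin: "(\<integral>\<^sup>+x. ennreal (- xlnx (f x)) \<partial>\<mu>) < \<infinity>"
    by (simp add: emeasure_space_1 order_le_less_trans[OF _ ennreal_one_less_top])
  have *: "KL ?\<alpha> \<mu> = enn2ereal (\<integral>\<^sup>+x. ennreal (xlnx (f x)) \<partial>\<mu>)
      - enn2ereal (\<integral>\<^sup>+x. ennreal (- xlnx (f x)) \<partial>\<mu>)"
    using ac by (simp add: KL_def ext_integral_def pos neg)
  show ?thesis
  proof (cases "integrable \<mu> (\<lambda>x. xlnx (f x))")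
    case True
    note int = this
    show ?thesis using int integrableD(2,3)[OF int]
      unfolding * real_lebesgue_integral_def[OF int]
      by (cases "\<integral>\<^sup>+x. ennreal (xlnx (f x)) \<partial>\<mu>"; cases "\<integral>\<^sup>+x. ennreal (- xlnx (f x)) \<partial>\<mu>")
         (auto simp: enn2ereal_ennreal)
  next
    case False
    then have "(\<integral>\<^sup>+x. ennreal (xlnx (f x)) \<partial>\<mu>) = \<infinity>"
      using fin by (auto simp: real_integrable_def less_top[symmetric])
    then show ?thesis using False fin unfolding *
      by (cases "\<integral>\<^sup>+x. ennreal (- xlnx (f x)) \<partial>\<mu>") (auto simp: enn2ereal_ennreal)
  qed
qed

lemma density_exists:
  assumes "prob_space \<mu>" "prob_space \<alpha>" "sets \<alpha> = sets \<mu>" "absolutely_continuous \<mu> \<alpha>"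
  obtains f :: "'a \<Rightarrow> real" where "f \<in> borel_measurable \<mu>" "\<And>x. 0 \<le> f x"
    "\<alpha> = density \<mu> (\<lambda>x. ennreal (f x))"
    "integrable \<mu> f" "integral\<^sup>L \<mu> f = 1"
proof -
  interpret M: prob_space \<mu> by fact
  interpret A: prob_space \<alpha> by fact
  let ?f = "\<lambda>x. enn2real (RN_deriv \<mu> \<alpha> x)"
  have "AE x in \<mu>. RN_deriv \<mu> \<alpha> x \<noteq> \<infinity>"
    using assms A.sigma_finite_measure_axioms by (intro M.RN_deriv_finite) auto
  then have "density \<mu> (\<lambda>x. ennreal (?f x)) = density \<mu> (RN_deriv \<mu> \<alpha>)"
    by (intro density_cong) (auto elim!: eventually_mono simp: less_top)
  also have "\<dots> = \<alpha>" using assms by (intro M.density_RN_deriv)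
  finally have d: "\<alpha> = density \<mu> (\<lambda>x. ennreal (?f x))" by simp
  have "(\<integral>\<^sup>+x. ennreal (?f x) \<partial>\<mu>) = emeasure \<alpha> (space \<mu>)"
    by (subst d) (simp add: emeasure_density cong: nn_integral_cong)
  also have "\<dots> = 1" using A.emeasure_space_1 sets_eq_imp_space_eq[OF assms(3)] by simp
  finally have one: "(\<integral>\<^sup>+x. ennreal (?f x) \<partial>\<mu>) = 1" .
  then have "integrable \<mu> ?f" by (intro integrableI_nonneg) auto
  moreover from one have "integral\<^sup>L \<mu> ?f = 1" by (simp add: integral_eq_nn_integral)
  ultimately show ?thesis using d by (intro that[of ?f]) auto
qed

lemma KL_finite_density:
  assumes "prob_space \<mu>" "prob_space \<alpha>" "sets \<alpha> = sets \<mu>" "KL \<alpha> \<mu> = ereal k"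
  obtains f :: "'a \<Rightarrow> real" where "f \<in> borel_measurable \<mu>" "\<And>x. 0 \<le> f x"
    "\<alpha> = density \<mu> (\<lambda>x. ennreal (f x))" "integrable \<mu> f" "integral\<^sup>L \<mu> f = 1"
    "integrable \<mu> (\<lambda>x. xlnx (f x))" "(\<integral>x. xlnx (f x) \<partial>\<mu>) = k"
proof -
  have "absolutely_continuous \<mu> \<alpha>" using assms(4) by (auto simp: KL_def split: if_splits)
  from density_exists[OF assms(1-3) this] obtain f :: "'a \<Rightarrow> real" where
    f: "f \<in> borel_measurable \<mu>" "\<And>x. 0 \<le> f x" "\<alpha> = density \<mu> (\<lambda>x. ennreal (f x))"
      "integrable \<mu> f" "integral\<^sup>L \<mu> f = 1" by blast
  with KL_density_eq_integral[OF assms(1) f(1,2)] assms(4) show ?thesis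
    by (intro that[of f]) (auto split: if_splits)
qed

lemma KL_nonneg:
  assumes "prob_space \<mu>" "prob_space \<alpha>" "sets \<alpha> = sets \<mu>"
  shows "0 \<le> KL \<alpha> \<mu>"
proof (cases "absolutely_continuous \<mu> \<alpha>")
  case True
  interpret prob_space \<mu> by fact
  from density_exists[OF assms True] obtain f :: "'a \<Rightarrow> real" where
    f: "f \<in> borel_measurable \<mu>" "\<And>x. 0 \<le> f x" "\<alpha> = density \<mu> (\<lambda>x. ennreal (f x))"
      "integrable \<mu> f" "integral\<^sup>L \<mu> f = 1" by blast
  have "0 \<le> (\<integral>x. xlnx (f x) \<partial>\<mu>)" if "integrable \<mu> (\<lambda>x. xlnx (f x))"
  proof -
    have "(\<integral>x. f x - 1 \<partial>\<mu>) \<le> (\<integral>x. xlnx (f x) \<partial>\<mu>)"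
      using f that by (intro integral_mono) (auto simp: xlnx_ge)
    then show ?thesis using f by (simp add: prob_space)
  qed
  then show ?thesis using KL_density_eq_integral[OF assms(1) f(1,2)] f(3) by simp
qed (simp add: KL_def)

lemma KL_self:
  assumes "prob_space \<mu>"
  shows "KL \<mu> \<mu> = 0"
  using KL_density_eq_integral[OF assms, of "\<lambda>_. 1"] by (simp add: density_1 xlnx_def zero_ereal_def)

text \<open>
  Since \<open>xlnx\<close> is bounded below, an integrable upper bound alone makes the entropy finite.
\<close>
lemma KL_density_le:
  assumes "prob_space \<mu>" and [measurable]: "f \<in> borel_measurable \<mu>" and "\<And>x. 0 \<le> f x"
    and "AE x in \<mu>. xlnx (f x) \<le> g x" and g: "integrable \<mu> g"
  obtains k where "KL (density \<mu> (\<lambda>x. ennreal (f x))) \<mu> = ereal k" "k \<le> integral\<^sup>L \<mu> g"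
proof -
  interpret prob_space \<mu> by fact
  have int: "integrable \<mu> (\<lambda>x. xlnx (f x))"
  proof (rule Bochner_Integration.integrable_bound)
    show "integrable \<mu> (\<lambda>x. \<bar>g x\<bar> + 1)" using g by simp
    show "AE x in \<mu>. norm (xlnx (f x)) \<le> norm (\<bar>g x\<bar> + 1)"
      using assms(4)
    proof eventually_elim
      case (elim x)
      have "- 1 \<le> xlnx (f x)" using xlnx_ge[OF assms(3)[of x]] assms(3)[of x] by linarith
      with elim show ?case by simp
    qed
  qed simp
  show ?thesis
    using int assms g KL_density_eq_integral[OF assms(1-3)]
    by (intro that[of "\<integral>x. xlnx (f x) \<partial>\<mu>"]) (auto intro!: integral_mono_AE)
qed

text \<open>
  Integrating the pointwise gap \<open>xlnx_midpoint_gap\<close> over the set \<open>A\<close> on which the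
  density of \<open>\<alpha>\<close> exceeds \<open>q\<close> times that of \<open>\<beta>\<close> gives the bound.  Thus an entropy that is nearly affine on the segment from \<open>\<alpha>\<close> to \<open>\<beta>\<close> forces
  \<open>\<alpha> A\<close> to be small, while off \<open>A\<close> the measure \<open>\<alpha>\<close> is dominated by \<open>q \<beta>\<close>.  The conclusion
  speaks of measures only, so that densities do not appear in its applications.
\<close>
lemma KL_midpoint:
  assumes \<mu>: "prob_space \<mu>" and \<alpha>: "prob_space \<alpha>" "sets \<alpha> = sets \<mu>" "KL \<alpha> \<mu> = ereal a"
    and \<beta>: "prob_space \<beta>" "sets \<beta> = sets \<mu>" "KL \<beta> \<mu> = ereal b"
    and \<gamma>: "sets \<gamma> = sets \<mu>"
      "\<And>A. A \<in> sets \<mu> \<Longrightarrow> emeasure \<gamma> A = (emeasure \<alpha> A + emeasure \<beta> A) / 2"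
    and q: "1 < q"
  obtains k A where "KL \<gamma> \<mu> = ereal k" "A \<in> sets \<mu>"
    "k + gap_rate q * measure \<alpha> A \<le> (a + b) / 2"
    "\<And>B. B \<in> sets \<mu> \<Longrightarrow> A \<inter> B = {} \<Longrightarrow> emeasure \<alpha> B \<le> ennreal q * emeasure \<beta> B"
proof -
  interpret prob_space \<mu> by fact
  from KL_finite_density[OF \<mu> \<alpha>] obtain f where
    [measurable]: "f \<in> borel_measurable \<mu>" and
    f: "\<And>x. 0 \<le> f x" "\<alpha> = density \<mu> (\<lambda>x. ennreal (f x))" "integrable \<mu> f"
      "integrable \<mu> (\<lambda>x. xlnx (f x))" "(\<integral>x. xlnx (f x) \<partial>\<mu>) = a" by metis
  from KL_finite_density[OF \<mu> \<beta>] obtain g where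
    [measurable]: "g \<in> borel_measurable \<mu>" and
    g: "\<And>x. 0 \<le> g x" "\<beta> = density \<mu> (\<lambda>x. ennreal (g x))" "integrable \<mu> g"
      "integrable \<mu> (\<lambda>x. xlnx (g x))" "(\<integral>x. xlnx (g x) \<partial>\<mu>) = b" by metis
  define A where "A = {x \<in> space \<mu>. q * g x < f x}"
  have A[measurable]: "A \<in> sets \<mu>" by (simp add: A_def)
  have "\<gamma> = density \<mu> (\<lambda>x. ennreal ((f x + g x) / 2))" (is "_ = ?d")
  proof (rule measure_eqI)
    fix B assume "B \<in> sets \<gamma>"
    then have [measurable]: "B \<in> sets \<mu>" using \<gamma> by simp
    have half: "ennreal ((f x + g x) / 2) = (ennreal (f x) + ennreal (g x)) / 2" for x
      using f(1)[of x] g(1)[of x] by (metis add_nonneg_nonneg ennreal_divide_numeral ennreal_plus)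
    have "emeasure ?d B = (\<integral>\<^sup>+x. (ennreal (f x) * indicator B x + ennreal (g x) * indicator B x) / 2 \<partial>\<mu>)"
      using f(1) g(1) by (subst emeasure_density)
        (auto intro!: nn_integral_cong split: split_indicator simp: half)
    also have "\<dots> = (emeasure \<alpha> B + emeasure \<beta> B) / 2"
      by (simp add: nn_integral_divide nn_integral_add f(2) g(2) emeasure_density)
    finally show "emeasure \<gamma> B = emeasure ?d B" using \<gamma>(2)[of B] by simp
  qed (simp add: \<gamma>)
  moreover have i: "integrable \<mu> (\<lambda>x. f x * indicator A x)"
    using f by (intro integrable_real_mult_indicator) auto
  have "xlnx ((f x + g x) / 2) \<le> (xlnx (f x) + xlnx (g x)) / 2 - gap_rate q * (f x * indicator A x)"
    if "x \<in> space \<mu>" for x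
    using that xlnx_midpoint[OF f(1) g(1), of x x] xlnx_midpoint_gap[OF q g(1), of x "f x"]
    by (cases "x \<in> A") (auto simp: A_def field_simps)
  then have "AE x in \<mu>. xlnx ((f x + g x) / 2)
      \<le> (xlnx (f x) + xlnx (g x)) / 2 - gap_rate q * (f x * indicator A x)" by simp
  ultimately obtain k where k: "KL \<gamma> \<mu> = ereal k"
    "k \<le> (\<integral>x. (xlnx (f x) + xlnx (g x)) / 2 - gap_rate q * (f x * indicator A x) \<partial>\<mu>)"
    using KL_density_le[OF \<mu>, of "\<lambda>x. (f x + g x) / 2"
      "\<lambda>x. (xlnx (f x) + xlnx (g x)) / 2 - gap_rate q * (f x * indicator A x)"] f g i by auto
  have "measure \<alpha> A = (\<integral>x. f x * indicator A x \<partial>\<mu>)"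
    by (subst f(2), subst measure_def, subst emeasure_density)
      (auto intro!: arg_cong[where f=enn2real] nn_integral_cong
        simp: integral_eq_nn_integral f(1) split: split_indicator)
  moreover have "(\<integral>x. (xlnx (f x) + xlnx (g x)) / 2 - gap_rate q * (f x * indicator A x) \<partial>\<mu>)
      = (a + b) / 2 - gap_rate q * (\<integral>x. f x * indicator A x \<partial>\<mu>)"
    using f g i by simp
  ultimately have "k + gap_rate q * measure \<alpha> A \<le> (a + b) / 2" using k(2) by (simp only: le_diff_eq)
  moreover have "emeasure \<alpha> B \<le> ennreal q * emeasure \<beta> B" if [measurable]: "B \<in> sets \<mu>" and "A \<inter> B = {}" for B
  proof -
    have "f x \<le> q * g x" if "x \<in> B" for x
      using that \<open>A \<inter> B = {}\<close> sets.sets_into_space[OF \<open>B \<in> sets \<mu>\<close>] by (force simp: A_def)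
    then have "(\<integral>\<^sup>+x. ennreal (f x) * indicator B x \<partial>\<mu>) \<le> (\<integral>\<^sup>+x. ennreal q * (ennreal (g x) * indicator B x) \<partial>\<mu>)"
      using q by (intro nn_integral_mono)
        (auto simp: ennreal_mult'[symmetric] split: split_indicator intro!: ennreal_leI)
    then show ?thesis by (simp add: f(2) g(2) emeasure_density nn_integral_cmult)
  qed
  ultimately show ?thesis using that k(1) A by blast
qed

text \<open>
  With \<open>s = 1 - 1/m\<close> this is \<open>m\<close> times the binary entropy of \<open>s\<close>, the price of reading
  \<open>\<beta>\<close> as a mixture of \<open>\<alpha>\<close> with weight \<open>1 - s\<close> and another measure with weight \<open>s\<close>.
\<close>
definition dominance_cost :: "real \<Rightarrow> real" where
  "dominance_cost m = xlnx m - xlnx (m - 1)"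

lemma dominance_cost_nonneg: "1 \<le> m \<Longrightarrow> 0 \<le> dominance_cost m"
  using xlnx_superadditive[of 1 "m - 1"] by (simp add: dominance_cost_def xlnx_def)

text \<open>
  The right-hand side of the estimate for the drop of the penalty between two minimisers.
\<close>
lemma truncation_error_tendsto_0:
  "((\<lambda>q::real. (q - 1) * C + D * ((q\<^sup>2 - 1) * E + 2 * dominance_cost (q\<^sup>2))) \<longlongrightarrow> 0) (at_right 1)"
  unfolding dominance_cost_def xlnx_def by real_asymp

text \<open>
  Relative entropy is not upper semicontinuous, but it is along measures dominated by
  \<open>m \<beta>\<close> with \<open>m\<close> tending to 1.  If \<open>h \<le> m f\<close> are the densities,
  then \<open>m f = h + u\<close> with \<open>u \<ge> 0\<close> of mass \<open>m - 1\<close>.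
  Superadditivity of \<open>xlnx\<close> gives \<open>xlnx h \<le> xlnx (m f) - xlnx u\<close>, and the tangent line at
  \<open>m - 1\<close> bounds the integral of \<open>xlnx u\<close> below by \<open>xlnx (m - 1)\<close>.
\<close>
lemma KL_dominated:
  assumes \<mu>: "prob_space \<mu>" and \<alpha>: "prob_space \<alpha>" "sets \<alpha> = sets \<mu>"
    and \<beta>: "prob_space \<beta>" "sets \<beta> = sets \<mu>" "KL \<beta> \<mu> = ereal b"
    and m: "1 < m" and dom: "\<And>A. A \<in> sets \<mu> \<Longrightarrow> emeasure \<alpha> A \<le> ennreal m * emeasure \<beta> A"
  obtains k where "KL \<alpha> \<mu> = ereal k" "k \<le> m * b + dominance_cost m"
proof -
  interpret prob_space \<mu> by fact
  from KL_finite_density[OF \<mu> \<beta>] obtain f where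
    [measurable]: "f \<in> borel_measurable \<mu>" and
    f: "\<And>x. 0 \<le> f x" "\<beta> = density \<mu> (\<lambda>x. ennreal (f x))" "integrable \<mu> f" "integral\<^sup>L \<mu> f = 1"
      "integrable \<mu> (\<lambda>x. xlnx (f x))" "(\<integral>x. xlnx (f x) \<partial>\<mu>) = b" by metis
  have "absolutely_continuous \<mu> \<beta>" unfolding f(2) by (intro absolutely_continuousI_density) simp
  then have "absolutely_continuous \<mu> \<alpha>"
    using dom \<alpha>(2) unfolding absolutely_continuous_def by (fastforce simp: null_sets_def)
  from density_exists[OF \<mu> \<alpha> this] obtain h :: "'a \<Rightarrow> real" where
    [measurable]: "h \<in> borel_measurable \<mu>" and
    h: "\<And>x. 0 \<le> h x" "\<alpha> = density \<mu> (\<lambda>x. ennreal (h x))" "integrable \<mu> h" "integral\<^sup>L \<mu> h = 1"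
    by blast
  have le: "AE x in \<mu>. h x \<le> m * f x"
  proof -
    define A where "A = {x \<in> space \<mu>. m * f x < h x}"
    have A[measurable]: "A \<in> sets \<mu>" by (simp add: A_def)
    have int: "integrable \<mu> (\<lambda>x. f x * indicator A x)" "integrable \<mu> (\<lambda>x. h x * indicator A x)"
      using f h by (auto intro!: integrable_real_mult_indicator)
    have eq: "emeasure (density \<mu> (\<lambda>x. ennreal (u x))) A = ennreal (\<integral>x. u x * indicator A x \<partial>\<mu>)"
      if "\<And>x. 0 \<le> u x" "integrable \<mu> (\<lambda>x. u x * indicator A x)" and [measurable]: "u \<in> borel_measurable \<mu>"
      for u :: "'a \<Rightarrow> real"
      using that by (subst emeasure_density)
        (auto simp: nn_integral_eq_integral[symmetric] split: split_indicator intro!: nn_integral_cong)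
    have "ennreal (\<integral>x. h x * indicator A x \<partial>\<mu>) \<le> ennreal m * ennreal (\<integral>x. f x * indicator A x \<partial>\<mu>)"
      using dom[OF A] f h int by (simp add: eq)
    then have "(\<integral>x. h x * indicator A x \<partial>\<mu>) \<le> m * (\<integral>x. f x * indicator A x \<partial>\<mu>)"
      using m f(1) by (subst (asm) ennreal_mult'[symmetric]) (auto simp: ennreal_le_iff)
    then have "(\<integral>x. (h x - m * f x) * indicator A x \<partial>\<mu>) \<le> 0"
      using int by (simp add: left_diff_distrib mult.assoc)
    moreover have "0 \<le> (h x - m * f x) * indicator A x" for x
      by (auto simp: A_def split: split_indicator)
    moreover have "integrable \<mu> (\<lambda>x. (h x - m * f x) * indicator A x)"
      using int by (simp add: left_diff_distrib mult.assoc)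
    ultimately have "AE x in \<mu>. (h x - m * f x) * indicator A x = 0"
      by (subst integral_nonneg_eq_0_iff_AE[symmetric]) (auto intro!: antisym integral_nonneg)
    then show ?thesis using AE_space
      by eventually_elim (auto simp: A_def not_less split: split_indicator_asm)
  qed
  \<comment> \<open>the bound on the entropy of \<open>h\<close> with the tangent line in place of \<open>xlnx (m f - h)\<close>\<close>
  let ?r = "\<lambda>x::'a. m * xlnx (f x) + xlnx m * f x - (xlnx (m - 1) + (1 + ln (m - 1)) * (m * f x - h x - (m - 1)))"
  have "AE x in \<mu>. xlnx (h x) \<le> ?r x"
    using le
  proof eventually_elim
    case (elim x)
    have "xlnx (h x) + xlnx (m * f x - h x) \<le> xlnx (m * f x)"
      using xlnx_superadditive[of "h x" "m * f x - h x"] h elim by simp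
    moreover have "xlnx (m - 1) + (1 + ln (m - 1)) * (m * f x - h x - (m - 1)) \<le> xlnx (m * f x - h x)"
      using elim m by (intro xlnx_tangent) auto
    moreover have "xlnx (m * f x) = m * xlnx (f x) + xlnx m * f x"
      using m f by (intro xlnx_mult) auto
    ultimately show ?case by linarith
  qed
  moreover have "integrable \<mu> ?r" using f h by simp
  ultimately obtain k where k: "KL \<alpha> \<mu> = ereal k" "k \<le> integral\<^sup>L \<mu> ?r"
    using KL_density_le[where \<mu> = \<mu> and f = h and g = ?r, OF \<mu> _ h(1)] h(2) by auto
  have "integral\<^sup>L \<mu> ?r = m * b + dominance_cost m"
    using f h by (simp add: dominance_cost_def prob_space)
  then show ?thesis using that k by auto
qed

section \<open>Measures with finite second moment\<close>

text \<open>
  The superlevel sets are open.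
\<close>
lemma lower_semicontinuous_measurable:
  fixes f :: "'a::topological_space \<Rightarrow> real"
  assumes "lower_semicontinuous f"
  shows "f \<in> borel_measurable borel"
proof (subst borel_measurable_iff_greater, intro allI)
  fix a :: real
  have "open {x. a < f x}"
  proof (subst open_subopen, intro ballI)
    fix x assume "x \<in> {x. a < f x}"
    then have x: "ereal a < ereal (f x)" by simp
    also have "\<dots> \<le> Liminf (at x) (\<lambda>y. ereal (f y))"
      using assms by (simp add: lower_semicontinuous_def)
    finally have "eventually (\<lambda>y. a < f y) (at x)"
      using less_LiminfD by fastforce
    then obtain S where "open S" "x \<in> S" "\<forall>y\<in>S. y \<noteq> x \<longrightarrow> a < f y"
      unfolding eventually_at_topological by blast
    with x show "\<exists>T. open T \<and> x \<in> T \<and> T \<subseteq> {x. a < f x}" by (intro exI[of _ S]) auto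
  qed
  then show "{w \<in> space borel. a < f w} \<in> sets borel" by simp
qed

lemma P2_iff:
  fixes M :: "'a::euclidean_space measure"
  shows "M \<in> P2 \<longleftrightarrow> prob_space M \<and> sets M = sets borel \<and> (\<integral>\<^sup>+x. ennreal ((norm x)\<^sup>2) \<partial>M) < \<infinity>"
proof -
  have "integrable M (\<lambda>x. (norm x)\<^sup>2) \<longleftrightarrow> (\<integral>\<^sup>+x. ennreal ((norm x)\<^sup>2) \<partial>M) < \<infinity>" if "sets M = sets borel"
  proof -
    have "(\<lambda>x. (norm x)\<^sup>2) \<in> borel_measurable M" unfolding measurable_cong_sets[OF that refl] by measurable
    then show ?thesis by (simp add: integrable_iff_bounded)
  qed
  then show ?thesis unfolding P2_def by auto
qed

text \<open>
  The law obtained by tossing a fair coin and then drawing from \<open>\<rho>\<close> or from \<open>\<sigma>\<close>.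
\<close>
lemma midpoint_measure_exists:
  assumes "prob_space \<rho>" "prob_space \<sigma>" "sets \<sigma> = sets \<rho>"
  obtains \<tau> where "prob_space \<tau>" "sets \<tau> = sets \<rho>"
    "\<And>f. f \<in> borel_measurable \<rho> \<Longrightarrow> (\<integral>\<^sup>+x. f x \<partial>\<tau>) = ((\<integral>\<^sup>+x. f x \<partial>\<rho>) + (\<integral>\<^sup>+x. f x \<partial>\<sigma>)) / 2"
    "\<And>A. A \<in> sets \<rho> \<Longrightarrow> emeasure \<tau> A = (emeasure \<rho> A + emeasure \<sigma> A) / 2"
proof -
  let ?N = "\<lambda>b. if b then \<rho> else \<sigma>"
  define \<tau> where "\<tau> = measure_pmf (bernoulli_pmf (1/2)) \<bind> ?N"
  have N: "?N \<in> measurable (measure_pmf (bernoulli_pmf (1/2))) (subprob_algebra \<rho>)"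
    using assms by (auto simp: space_subprob_algebra prob_space_imp_subprob_space)
  have sets: "sets \<tau> = sets \<rho>"
    unfolding \<tau>_def using assms by (subst sets_bind[where N=\<rho>]) auto
  have int: "(\<integral>\<^sup>+x. f x \<partial>\<tau>) = ((\<integral>\<^sup>+x. f x \<partial>\<rho>) + (\<integral>\<^sup>+x. f x \<partial>\<sigma>)) / 2"
    if "f \<in> borel_measurable \<rho>" for f
    unfolding \<tau>_def using nn_integral_bind[OF that N]
    by (simp add: divide_ennreal_def distrib_right)
  have em: "emeasure \<tau> A = (emeasure \<rho> A + emeasure \<sigma> A) / 2" if "A \<in> sets \<rho>" for A
    using int[of "indicator A"] that assms sets by simp
  have "space \<tau> = space \<rho>" "space \<sigma> = space \<rho>" using sets assms by (auto dest: sets_eq_imp_space_eq)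
  then have "emeasure \<tau> (space \<tau>) = 1"
    using em[of "space \<rho>"] assms(1,2)[THEN prob_space.emeasure_space_1]
    by (simp add: ennreal_divide_self)
  then have "prob_space \<tau>" by (rule prob_spaceI)
  then show ?thesis using that sets int em by blast
qed

lemma prob_space_marginals:
  fixes \<rho> :: "('a::euclidean_space \<times> 'b::euclidean_space) measure"
  assumes "prob_space \<rho>" "sets \<rho> = sets borel"
  shows "prob_space (marginal1 \<rho>)" "prob_space (marginal2 \<rho>)"
    and "fst \<in> measurable \<rho> borel" "snd \<in> measurable \<rho> borel"
proof -
  show m: "fst \<in> measurable \<rho> borel" "snd \<in> measurable \<rho> borel"
    unfolding measurable_cong_sets[OF assms(2) refl] borel_prod[symmetric] by measurable
  then show "prob_space (marginal1 \<rho>)" "prob_space (marginal2 \<rho>)"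
    using assms by (auto intro: prob_space.prob_space_distr)
qed

section \<open>The penalised transport problem and its competitors\<close>

locale penalised_transport =
  fixes c :: "('a::euclidean_space) \<times> ('b::euclidean_space) \<Rightarrow> real"
    and \<mu> :: "'a measure" and \<nu> :: "'b measure"
  assumes cost_nonneg: "\<And>z. 0 \<le> c z" and cost_measurable: "c \<in> borel_measurable borel"
    and \<mu>: "\<mu> \<in> P2" and \<nu>: "\<nu> \<in> P2"
begin

definition admissible :: "('a \<times> 'b) measure \<Rightarrow> bool" where
  "admissible \<rho> \<longleftrightarrow> \<rho> \<in> P2 \<and> (\<integral>\<^sup>+z. ennreal (c z) \<partial>\<rho>) < \<infinity> \<and>
     KL (marginal1 \<rho>) \<mu> < \<infinity> \<and> KL (marginal2 \<rho>) \<nu> < \<infinity>"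

definition cost :: "('a \<times> 'b) measure \<Rightarrow> real" where
  "cost \<rho> = enn2real (\<integral>\<^sup>+z. ennreal (c z) \<partial>\<rho>)"

definition penalty1 :: "('a \<times> 'b) measure \<Rightarrow> real" where "penalty1 \<rho> = real_of_ereal (KL (marginal1 \<rho>) \<mu>)"
definition penalty2 :: "('a \<times> 'b) measure \<Rightarrow> real" where "penalty2 \<rho> = real_of_ereal (KL (marginal2 \<rho>) \<nu>)"

definition penalty :: "('a \<times> 'b) measure \<Rightarrow> real" where "penalty \<rho> = penalty1 \<rho> + penalty2 \<rho>"

lemma prob_sets_reference:
  "prob_space \<mu>" "sets \<mu> = sets borel" "prob_space \<nu>" "sets \<nu> = sets borel"
  using \<mu> \<nu> by (auto simp: P2_def)

lemma KL_marginal_nonneg: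
  assumes "\<rho> \<in> P2"
  shows "0 \<le> KL (marginal1 \<rho>) \<mu>" "0 \<le> KL (marginal2 \<rho>) \<nu>"
  using assms prob_sets_reference by (auto simp: P2_def intro!: KL_nonneg prob_space_marginals)

lemma admissibleD:
  assumes "admissible \<rho>"
  shows "prob_space \<rho>" "sets \<rho> = sets borel" "\<rho> \<in> P2"
    "(\<integral>\<^sup>+z. ennreal (c z) \<partial>\<rho>) = ennreal (cost \<rho>)" "0 \<le> cost \<rho>"
    "KL (marginal1 \<rho>) \<mu> = ereal (penalty1 \<rho>)" "0 \<le> penalty1 \<rho>"
    "KL (marginal2 \<rho>) \<nu> = ereal (penalty2 \<rho>)" "0 \<le> penalty2 \<rho>"
proof -
  show "\<rho> \<in> P2" and "prob_space \<rho>" "sets \<rho> = sets borel"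
    using assms by (auto simp: admissible_def P2_def)
  from KL_marginal_nonneg[OF this(1)] assms
  show "KL (marginal1 \<rho>) \<mu> = ereal (penalty1 \<rho>)" "0 \<le> penalty1 \<rho>"
    "KL (marginal2 \<rho>) \<nu> = ereal (penalty2 \<rho>)" "0 \<le> penalty2 \<rho>"
    unfolding admissible_def penalty1_def penalty2_def
    by (auto simp: ereal_real real_of_ereal_pos)
  show "(\<integral>\<^sup>+z. ennreal (c z) \<partial>\<rho>) = ennreal (cost \<rho>)" "0 \<le> cost \<rho>"
    using assms unfolding admissible_def cost_def by auto
qed

lemma energy_admissible:
  assumes "admissible \<rho>"
  shows "energy c \<mu> \<nu> \<rho> L = ereal (cost \<rho> + L * penalty \<rho>)"
  using admissibleD[OF assms] by (simp add: energy_def penalty_def algebra_simps)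

text \<open>
  All three terms of the energy are nonnegative, so none can be infinite when their sum is not.
\<close>
lemma admissible_if_energy_finite:
  assumes "\<rho> \<in> P2" "0 < L" "energy c \<mu> \<nu> \<rho> L < \<infinity>"
  shows "admissible \<rho>"
  using assms KL_marginal_nonneg[OF assms(1)] unfolding energy_def admissible_def
  by (cases "KL (marginal1 \<rho>) \<mu>"; cases "KL (marginal2 \<rho>) \<nu>"; cases "\<integral>\<^sup>+z. ennreal (c z) \<partial>\<rho>")
    auto

text \<open>
  The marginals of the product are \<open>\<mu>\<close> and \<open>\<nu>\<close> themselves: the product has no penalty, and
  every minimal energy is bounded by its cost, whatever the penalty weight.
\<close>
lemma product_admissible:
  assumes "(\<integral>\<^sup>+y. (\<integral>\<^sup>+x. ennreal (c (x, y)) \<partial>\<mu>) \<partial>\<nu>) < \<infinity>"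
  shows "admissible (\<mu> \<Otimes>\<^sub>M \<nu>)" "penalty (\<mu> \<Otimes>\<^sub>M \<nu>) = 0"
proof -
  interpret M: prob_space \<mu> using prob_sets_reference by simp
  interpret N: prob_space \<nu> using prob_sets_reference by simp
  interpret P: pair_prob_space \<mu> \<nu> ..
  have "sets (\<mu> \<Otimes>\<^sub>M \<nu>) = sets (borel \<Otimes>\<^sub>M borel)"
    using prob_sets_reference by (intro sets_pair_measure_cong)
  then have s: "sets (\<mu> \<Otimes>\<^sub>M \<nu>) = sets borel" by (simp only: borel_prod)
  have ms: "f \<in> borel_measurable (\<mu> \<Otimes>\<^sub>M \<nu>)" if "f \<in> borel_measurable borel" for f :: "'a \<times> 'b \<Rightarrow> ennreal"
    using that measurable_cong_sets[OF s refl] by blast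
  have fst: "marginal1 (\<mu> \<Otimes>\<^sub>M \<nu>) = \<mu>"
    using N.distr_pair_fst[of \<mu>] distr_cong[OF refl, of borel \<mu> "\<mu> \<Otimes>\<^sub>M \<nu>" fst fst] prob_sets_reference
    by simp
  have snd: "marginal2 (\<mu> \<Otimes>\<^sub>M \<nu>) = \<nu>"
  proof (rule measure_eqI)
    fix B assume B: "B \<in> sets (marginal2 (\<mu> \<Otimes>\<^sub>M \<nu>))"
    then have [measurable]: "B \<in> sets \<nu>" using prob_sets_reference by simp
    have "snd -` B \<inter> space (\<mu> \<Otimes>\<^sub>M \<nu>) = space \<mu> \<times> B"
      using sets.sets_into_space[OF \<open>B \<in> sets \<nu>\<close>] by (auto simp: space_pair_measure)
    then show "emeasure (marginal2 (\<mu> \<Otimes>\<^sub>M \<nu>)) B = emeasure \<nu> B"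
      using B prob_space_marginals[OF P.prob_space_axioms s]
      by (simp add: emeasure_distr N.emeasure_pair_measure_Times M.emeasure_space_1)
  qed (simp add: prob_sets_reference)
  have "(\<integral>\<^sup>+z. ennreal ((norm z)\<^sup>2) \<partial>(\<mu> \<Otimes>\<^sub>M \<nu>))
      = (\<integral>\<^sup>+z. ennreal ((norm (fst z))\<^sup>2) + ennreal ((norm (snd z))\<^sup>2) \<partial>(\<mu> \<Otimes>\<^sub>M \<nu>))"
    by (simp add: norm_prod_def)
  also have "\<dots> = (\<integral>\<^sup>+x. ennreal ((norm x)\<^sup>2) \<partial>(marginal1 (\<mu> \<Otimes>\<^sub>M \<nu>))) + (\<integral>\<^sup>+x. ennreal ((norm x)\<^sup>2) \<partial>(marginal2 (\<mu> \<Otimes>\<^sub>M \<nu>)))"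
    using prob_space_marginals[OF P.prob_space_axioms s]
    by (subst nn_integral_add) (auto intro!: ms simp: nn_integral_distr borel_prod[symmetric, where 'a='a and 'b='b])
  also have "\<dots> < \<infinity>" using \<mu> \<nu> unfolding fst snd P2_iff by simp
  finally have "\<mu> \<Otimes>\<^sub>M \<nu> \<in> P2" using s P.prob_space_axioms by (simp add: P2_iff)
  moreover have "(\<integral>\<^sup>+z. ennreal (c z) \<partial>(\<mu> \<Otimes>\<^sub>M \<nu>)) < \<infinity>"
  proof -
    have "(\<lambda>z. ennreal (c z)) \<in> borel_measurable (\<mu> \<Otimes>\<^sub>M \<nu>)"
      using cost_measurable by (intro ms) measurable
    from P.nn_integral_snd[OF this] show ?thesis using assms by (simp only:)
  qed
  ultimately show "admissible (\<mu> \<Otimes>\<^sub>M \<nu>)" "penalty (\<mu> \<Otimes>\<^sub>M \<nu>) = 0"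
    using KL_self[OF prob_sets_reference(1)] KL_self[OF prob_sets_reference(3)]
    by (simp_all add: admissible_def penalty_def penalty1_def penalty2_def fst snd)
qed

text \<open>
  The cost is affine and only the penalty is convex, so a near-minimiser \<open>\<rho>\<close> of a problem
  with minimiser \<open>\<sigma>\<close> has little mass over \<open>A1\<close> and \<open>A2\<close>, where its marginals exceed \<open>q\<close>
  times those of \<open>\<sigma>\<close>.
\<close>
lemma midpoint_competitor:
  assumes \<rho>: "admissible \<rho>" and \<sigma>: "admissible \<sigma>" and q: "1 < q"
  obtains \<tau> A1 A2 where "admissible \<tau>" "cost \<tau> = (cost \<rho> + cost \<sigma>) / 2"
    "A1 \<in> sets borel" "A2 \<in> sets borel"
    "penalty \<tau> + gap_rate q * (measure (marginal1 \<rho>) A1 + measure (marginal2 \<rho>) A2)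
       \<le> (penalty \<rho> + penalty \<sigma>) / 2"
    "\<And>B. B \<in> sets borel \<Longrightarrow> A1 \<inter> B = {} \<Longrightarrow>
       emeasure (marginal1 \<rho>) B \<le> ennreal q * emeasure (marginal1 \<sigma>) B"
    "\<And>B. B \<in> sets borel \<Longrightarrow> A2 \<inter> B = {} \<Longrightarrow>
       emeasure (marginal2 \<rho>) B \<le> ennreal q * emeasure (marginal2 \<sigma>) B"
proof -
  note ref = prob_sets_reference
  note r = admissibleD[OF \<rho>] and s = admissibleD[OF \<sigma>]
  from midpoint_measure_exists[OF r(1) s(1)] r(2) s(2) obtain \<tau> where
    t: "prob_space \<tau>" "sets \<tau> = sets borel"
    and int: "\<And>f. f \<in> borel_measurable borel \<Longrightarrow> (\<integral>\<^sup>+x. f x \<partial>\<tau>) = ((\<integral>\<^sup>+x. f x \<partial>\<rho>) + (\<integral>\<^sup>+x. f x \<partial>\<sigma>)) / 2"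
    and em: "\<And>A. A \<in> sets borel \<Longrightarrow> emeasure \<tau> A = (emeasure \<rho> A + emeasure \<sigma> A) / 2"
    by (metis measurable_cong_sets)
  have sp: "space \<tau> = UNIV" "space \<rho> = UNIV" "space \<sigma> = UNIV"
    using t(2) r(2) s(2) by (auto dest!: sets_eq_imp_space_eq)
  note mr = prob_space_marginals[OF r(1,2)] and ms = prob_space_marginals[OF s(1,2)]
    and mt = prob_space_marginals[OF t]
  have em1: "emeasure (marginal1 \<tau>) A = (emeasure (marginal1 \<rho>) A + emeasure (marginal1 \<sigma>) A) / 2"
    if "A \<in> sets borel" for A
    using that mr ms mt sp em[of "fst -` A"] measurable_sets[OF mt(3) that] t(2)
    by (simp add: emeasure_distr)
  note mid1 = KL_midpoint[OF ref(1) mr(1) _ r(6) ms(1) _ s(6) _ _ q, of "marginal1 \<tau>", unfolded ref(2)]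
  obtain k1 A1 where 1: "KL (marginal1 \<tau>) \<mu> = ereal k1" "A1 \<in> sets borel"
    "k1 + gap_rate q * measure (marginal1 \<rho>) A1 \<le> (penalty1 \<rho> + penalty1 \<sigma>) / 2"
    "\<And>B. B \<in> sets borel \<Longrightarrow> A1 \<inter> B = {} \<Longrightarrow>
       emeasure (marginal1 \<rho>) B \<le> ennreal q * emeasure (marginal1 \<sigma>) B"
    by (rule mid1) ((simp add: em1; fail) | blast)+
  have em2: "emeasure (marginal2 \<tau>) A = (emeasure (marginal2 \<rho>) A + emeasure (marginal2 \<sigma>) A) / 2"
    if "A \<in> sets borel" for A
    using that mr ms mt sp em[of "snd -` A"] measurable_sets[OF mt(4) that] t(2)
    by (simp add: emeasure_distr)
  note mid2 = KL_midpoint[OF ref(3) mr(2) _ r(8) ms(2) _ s(8) _ _ q, of "marginal2 \<tau>", unfolded ref(4)]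
  obtain k2 A2 where 2: "KL (marginal2 \<tau>) \<nu> = ereal k2" "A2 \<in> sets borel"
    "k2 + gap_rate q * measure (marginal2 \<rho>) A2 \<le> (penalty2 \<rho> + penalty2 \<sigma>) / 2"
    "\<And>B. B \<in> sets borel \<Longrightarrow> A2 \<inter> B = {} \<Longrightarrow>
       emeasure (marginal2 \<rho>) B \<le> ennreal q * emeasure (marginal2 \<sigma>) B"
    by (rule mid2) ((simp add: em2; fail) | blast)+
  have "(\<integral>\<^sup>+z. ennreal (c z) \<partial>\<tau>) = (ennreal (cost \<rho>) + ennreal (cost \<sigma>)) / 2"
    using int[of "\<lambda>z. ennreal (c z)"] cost_measurable r(4) s(4) by simp
  also have "\<dots> = ennreal ((cost \<rho> + cost \<sigma>) / 2)"
    using r(5) s(5) by (metis add_nonneg_nonneg ennreal_divide_numeral ennreal_plus)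
  finally have ct: "(\<integral>\<^sup>+z. ennreal (c z) \<partial>\<tau>) = ennreal ((cost \<rho> + cost \<sigma>) / 2)" .
  have "(\<integral>\<^sup>+z. ennreal ((norm z)\<^sup>2) \<partial>\<tau>) < \<infinity>"
    using r(3) s(3) int[of "\<lambda>z. ennreal ((norm z)\<^sup>2)"]
    by (simp add: P2_iff less_top[symmetric] ennreal_divide_eq_top_iff)
  then have "admissible \<tau>" using t ct 1(1) 2(1) by (simp add: admissible_def P2_iff)
  moreover have "cost \<tau> = (cost \<rho> + cost \<sigma>) / 2" using r(5) s(5) by (simp add: cost_def[of \<tau>] ct)
  moreover have "penalty \<tau> + gap_rate q * (measure (marginal1 \<rho>) A1 + measure (marginal2 \<rho>) A2)
       \<le> (penalty \<rho> + penalty \<sigma>) / 2"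
    using 1(1,3) 2(1,3) by (simp add: penalty_def penalty1_def[of \<tau>] penalty2_def[of \<tau>] field_simps)
  ultimately show ?thesis using that 1(2,4) 2(2,4) by blast
qed

text \<open>
  The competitor is \<open>\<rho>\<close> conditioned on the event that neither coordinate lies in its bad set.
  This event has mass at least \<open>1/q\<close>, so conditioning raises the cost by at most the factor \<open>q\<close>, and
  the new marginals are at most \<open>q \<cdot> q\<close> times those of \<open>\<sigma>\<close>.  The result has the cost of \<open>\<rho>\<close>
  and the penalty of \<open>\<sigma>\<close>, up to errors that vanish as \<open>q\<close> tends to 1.
\<close>
lemma truncated_competitor:
  assumes \<rho>: "admissible \<rho>" and \<sigma>: "admissible \<sigma>" and q: "1 < q"
    and A: "A1 \<in> sets borel" "A2 \<in> sets borel"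
    and small: "measure (marginal1 \<rho>) A1 + measure (marginal2 \<rho>) A2 \<le> 1 - 1 / q"
    and dom1: "\<And>B. B \<in> sets borel \<Longrightarrow> A1 \<inter> B = {} \<Longrightarrow>
       emeasure (marginal1 \<rho>) B \<le> ennreal q * emeasure (marginal1 \<sigma>) B"
    and dom2: "\<And>B. B \<in> sets borel \<Longrightarrow> A2 \<inter> B = {} \<Longrightarrow>
       emeasure (marginal2 \<rho>) B \<le> ennreal q * emeasure (marginal2 \<sigma>) B"
  obtains \<tau> where "admissible \<tau>" "cost \<tau> \<le> q * cost \<rho>"
    "penalty \<tau> \<le> q\<^sup>2 * penalty \<sigma> + 2 * dominance_cost (q\<^sup>2)"
proof -
  note ref = prob_sets_reference
  note r = admissibleD[OF \<rho>] and s = admissibleD[OF \<sigma>]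
  note mr = prob_space_marginals[OF r(1,2)] and ms = prob_space_marginals[OF s(1,2)]
  interpret prob_space \<rho> by (rule r)
  have sp: "space \<rho> = UNIV" "space \<sigma> = UNIV"
    using r(2) s(2) by (auto dest!: sets_eq_imp_space_eq)
  define G where "G = - (fst -` A1 \<union> snd -` A2)"
  have A': "fst -` A1 \<in> sets \<rho>" "snd -` A2 \<in> sets \<rho>"
    using measurable_sets[OF mr(3) A(1)] measurable_sets[OF mr(4) A(2)] sp by auto
  then have "space \<rho> - (fst -` A1 \<union> snd -` A2) \<in> sets \<rho>" by auto
  then have G: "G \<in> sets \<rho>" by (simp only: G_def sp Compl_eq_Diff_UNIV)
  have "prob G = 1 - prob (fst -` A1 \<union> snd -` A2)"
    unfolding G_def using prob_compl[of "fst -` A1 \<union> snd -` A2"] A' sp by (simp add: Compl_eq_Diff_UNIV)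
  moreover have "prob (fst -` A1 \<union> snd -` A2) \<le> prob (fst -` A1) + prob (snd -` A2)"
    using A' by (intro measure_Un_le)
  moreover have "prob (fst -` A1) + prob (snd -` A2) \<le> 1 - 1 / q"
    using small mr A sp by (simp add: measure_distr)
  ultimately have gq: "1 / q \<le> prob G" by linarith
  then have g0: "0 < prob G" using q by (smt (verit) divide_pos_pos)
  have scale: "x / emeasure \<rho> G \<le> ennreal q * x" for x :: ennreal
  proof -
    have "inverse (prob G) \<le> q" using gq g0 q by (simp add: field_simps)
    then have "inverse (emeasure \<rho> G) \<le> ennreal q"
      using g0 by (simp add: emeasure_eq_measure inverse_ennreal ennreal_leI)
    then show ?thesis by (simp add: divide_ennreal_def mult.commute mult_left_mono)
  qed
  define \<tau> where "\<tau> = uniform_measure \<rho> G"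
  have t: "prob_space \<tau>" "sets \<tau> = sets borel"
    using g0 r(2) unfolding \<tau>_def
    by (auto intro!: prob_space_uniform_measure simp: emeasure_eq_measure)
  have spt: "space \<tau> = UNIV" using sets_eq_imp_space_eq[OF t(2)] by simp
  note mt = prob_space_marginals[OF t]
  have int: "(\<integral>\<^sup>+z. f z \<partial>\<tau>) \<le> ennreal q * (\<integral>\<^sup>+z. f z \<partial>\<rho>)" if "f \<in> borel_measurable borel" for f
  proof -
    have f: "f \<in> borel_measurable \<rho>" using that by (simp only: measurable_cong_sets[OF r(2) refl])
    have "(\<integral>\<^sup>+z. f z \<partial>\<tau>) = (\<integral>\<^sup>+z. f z * indicator G z \<partial>\<rho>) / emeasure \<rho> G"
      unfolding \<tau>_def by (rule nn_integral_uniform_measure[OF f G])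
    also have "\<dots> \<le> ennreal q * (\<integral>\<^sup>+z. f z * indicator G z \<partial>\<rho>)" by (rule scale)
    also have "\<dots> \<le> ennreal q * (\<integral>\<^sup>+z. f z \<partial>\<rho>)"
      by (intro mult_left_mono nn_integral_mono) (auto split: split_indicator)
    finally show ?thesis .
  qed
  have em: "emeasure \<tau> B \<le> ennreal q * emeasure \<rho> (G \<inter> B)" if "B \<in> sets \<rho>" for B
    unfolding \<tau>_def using scale[of "emeasure \<rho> (G \<inter> B)"] G that by simp
  have q2: "1 < q\<^sup>2" using q by (simp add: one_less_power)
  have qq: "ennreal q * ennreal q = ennreal (q\<^sup>2)" using q by (simp add: ennreal_mult'[symmetric] power2_eq_square)
  have "emeasure (marginal1 \<tau>) B \<le> ennreal (q\<^sup>2) * emeasure (marginal1 \<sigma>) B" if B: "B \<in> sets borel" for B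
  proof -
    have "emeasure (marginal1 \<tau>) B \<le> ennreal q * emeasure \<rho> (G \<inter> fst -` B)"
      using B mt em[of "fst -` B"] measurable_sets[OF mr(3) B] sp spt by (simp add: emeasure_distr)
    also have "\<dots> \<le> ennreal q * emeasure (marginal1 \<rho>) (B - A1)"
      using A B mr sp measurable_sets[OF mr(3), of "B - A1"]
      by (auto simp: emeasure_distr G_def intro!: mult_left_mono emeasure_mono)
    also have "\<dots> \<le> ennreal q * (ennreal q * emeasure (marginal1 \<sigma>) (B - A1))"
      using A B by (intro mult_left_mono dom1) auto
    also have "\<dots> \<le> ennreal q * (ennreal q * emeasure (marginal1 \<sigma>) B)"
      using B by (intro mult_left_mono emeasure_mono) auto
    finally show ?thesis by (simp add: mult.assoc[symmetric] qq)
  qed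
  then obtain k1 where k1: "KL (marginal1 \<tau>) \<mu> = ereal k1" "k1 \<le> q\<^sup>2 * penalty1 \<sigma> + dominance_cost (q\<^sup>2)"
    using KL_dominated[OF ref(1) mt(1) _ ms(1) _ s(6) q2] ref(2) by auto
  have "emeasure (marginal2 \<tau>) B \<le> ennreal (q\<^sup>2) * emeasure (marginal2 \<sigma>) B" if B: "B \<in> sets borel" for B
  proof -
    have "emeasure (marginal2 \<tau>) B \<le> ennreal q * emeasure \<rho> (G \<inter> snd -` B)"
      using B mt em[of "snd -` B"] measurable_sets[OF mr(4) B] sp spt by (simp add: emeasure_distr)
    also have "\<dots> \<le> ennreal q * emeasure (marginal2 \<rho>) (B - A2)"
      using A B mr sp measurable_sets[OF mr(4), of "B - A2"]
      by (auto simp: emeasure_distr G_def intro!: mult_left_mono emeasure_mono)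
    also have "\<dots> \<le> ennreal q * (ennreal q * emeasure (marginal2 \<sigma>) (B - A2))"
      using A B by (intro mult_left_mono dom2) auto
    also have "\<dots> \<le> ennreal q * (ennreal q * emeasure (marginal2 \<sigma>) B)"
      using B by (intro mult_left_mono emeasure_mono) auto
    finally show ?thesis by (simp add: mult.assoc[symmetric] qq)
  qed
  then obtain k2 where k2: "KL (marginal2 \<tau>) \<nu> = ereal k2" "k2 \<le> q\<^sup>2 * penalty2 \<sigma> + dominance_cost (q\<^sup>2)"
    using KL_dominated[OF ref(3) mt(2) _ ms(2) _ s(8) q2] ref(4) by auto
  have ct: "(\<integral>\<^sup>+z. ennreal (c z) \<partial>\<tau>) \<le> ennreal (q * cost \<rho>)"
    using int[of "\<lambda>z. ennreal (c z)"] cost_measurable r(4,5) q by (simp add: ennreal_mult)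
  have "(\<integral>\<^sup>+z. ennreal ((norm z)\<^sup>2) \<partial>\<tau>) < \<infinity>"
    using r(3) order_le_less_trans[OF int[of "\<lambda>z. ennreal ((norm z)\<^sup>2)"]]
    by (auto simp: P2_iff ennreal_mult_less_top)
  then have "admissible \<tau>"
    using t k1(1) k2(1) order_le_less_trans[OF ct] by (simp add: admissible_def P2_iff)
  moreover have "cost \<tau> \<le> q * cost \<rho>"
    unfolding cost_def[of \<tau>] using enn2real_mono[OF ct] r(5) q by simp
  moreover have "penalty \<tau> \<le> q\<^sup>2 * penalty \<sigma> + 2 * dominance_cost (q\<^sup>2)"
    using k1 k2 by (simp add: penalty_def penalty1_def[of \<tau>] penalty2_def[of \<tau>] algebra_simps)
  ultimately show ?thesis using that by blast
qed

section \<open>Continuity of the penalty along minimisers\<close>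

definition minimiser :: "real \<Rightarrow> ('a \<times> 'b) measure \<Rightarrow> bool" where
  "minimiser L \<rho> \<longleftrightarrow> admissible \<rho> \<and>
     (\<forall>\<tau>. admissible \<tau> \<longrightarrow> cost \<rho> + L * penalty \<rho> \<le> cost \<tau> + L * penalty \<tau>)"

lemma minimiser_admissible: "minimiser L \<rho> \<Longrightarrow> admissible \<rho>"
  and minimiserD: "minimiser L \<rho> \<Longrightarrow> admissible \<tau> \<Longrightarrow> cost \<rho> + L * penalty \<rho> \<le> cost \<tau> + L * penalty \<tau>"
  by (auto simp: minimiser_def)

lemma penalty_nonneg: "admissible \<rho> \<Longrightarrow> 0 \<le> penalty \<rho>"
  using admissibleD[of \<rho>] by (simp add: penalty_def)

lemma is_best_response_minimiser:
  assumes L: "0 < L" and "is_best_response c \<mu> \<nu> L \<rho>" and \<pi>: "admissible \<pi>"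
  shows "minimiser L \<rho>"
proof -
  have \<rho>: "\<rho> \<in> P2" and min: "\<And>\<tau>. \<tau> \<in> P2 \<Longrightarrow> energy c \<mu> \<nu> \<rho> L \<le> energy c \<mu> \<nu> \<tau> L"
    using assms(2) by (auto simp: is_best_response_def is_arg_min_def not_less)
  have "energy c \<mu> \<nu> \<rho> L \<le> ereal (cost \<pi> + L * penalty \<pi>)"
    using min[OF admissibleD(3)[OF \<pi>]] energy_admissible[OF \<pi>] by simp
  then have "energy c \<mu> \<nu> \<rho> L < \<infinity>" by (rule order_le_less_trans) simp
  then have a: "admissible \<rho>" by (rule admissible_if_energy_finite[OF \<rho> L])
  show ?thesis unfolding minimiser_def
  proof (intro conjI a allI impI)
    fix \<tau> assume t: "admissible \<tau>"
    show "cost \<rho> + L * penalty \<rho> \<le> cost \<tau> + L * penalty \<tau>"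
      using min[OF admissibleD(3)[OF t]] energy_admissible[OF a, of L] energy_admissible[OF t, of L] by simp
  qed
qed

text \<open>
  Add the two minimality inequalities; the costs cancel.
\<close>
lemma penalty_antimono:
  assumes "L1 < L2" and \<rho>: "minimiser L1 \<rho>" and \<sigma>: "minimiser L2 \<sigma>"
  shows "penalty \<sigma> \<le> penalty \<rho>"
proof -
  have "(L2 - L1) * penalty \<sigma> \<le> (L2 - L1) * penalty \<rho>"
    using minimiserD[OF \<rho> minimiser_admissible[OF \<sigma>]] minimiserD[OF \<sigma> minimiser_admissible[OF \<rho>]]
    by (simp add: algebra_simps)
  then show ?thesis using \<open>L1 < L2\<close> by simp
qed

text \<open>
  Tested against the midpoint of \<open>\<rho>\<close> and \<open>\<sigma>\<close>, minimality of \<open>\<sigma>\<close> bounds the mass of \<open>\<rho>\<close>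
  over the bad sets; \<open>close\<close> is the condition that this bound is at most \<open>1 - 1/q\<close>.  Tested
  against the truncation of \<open>\<rho>\<close>, it shows that \<open>\<sigma>\<close> cannot cost much more than \<open>\<rho>\<close>.
  By minimality of \<open>\<rho>\<close>, its excess penalty is paid for by that difference of costs.
\<close>
lemma penalty_drop_bound:
  assumes L: "0 < L1" "L1 < L2" and q: "1 < q"
    and \<rho>: "minimiser L1 \<rho>" and \<sigma>: "minimiser L2 \<sigma>"
    and close: "(L2 - L1) * penalty \<rho> \<le> 2 * L2 * gap_rate q * (1 - 1 / q)"
  shows "L1 * (penalty \<rho> - penalty \<sigma>)
    \<le> (q - 1) * cost \<rho> + L2 * ((q\<^sup>2 - 1) * penalty \<sigma> + 2 * dominance_cost (q\<^sup>2))"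
proof -
  note r = minimiser_admissible[OF \<rho>] and s = minimiser_admissible[OF \<sigma>]
  have opt: "cost \<rho> + L1 * penalty \<rho> \<le> cost \<sigma> + L1 * penalty \<sigma>" by (rule minimiserD[OF \<rho> s])
  obtain \<tau> A1 A2 where \<tau>: "admissible \<tau>" "cost \<tau> = (cost \<rho> + cost \<sigma>) / 2"
    and A: "A1 \<in> sets borel" "A2 \<in> sets borel"
    and gap: "penalty \<tau> + gap_rate q * (measure (marginal1 \<rho>) A1 + measure (marginal2 \<rho>) A2)
       \<le> (penalty \<rho> + penalty \<sigma>) / 2"
    and dom: "\<And>B. B \<in> sets borel \<Longrightarrow> A1 \<inter> B = {} \<Longrightarrow>
       emeasure (marginal1 \<rho>) B \<le> ennreal q * emeasure (marginal1 \<sigma>) B"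
    "\<And>B. B \<in> sets borel \<Longrightarrow> A2 \<inter> B = {} \<Longrightarrow>
       emeasure (marginal2 \<rho>) B \<le> ennreal q * emeasure (marginal2 \<sigma>) B"
    using midpoint_competitor[OF r s q] by metis
  define m where "m = measure (marginal1 \<rho>) A1 + measure (marginal2 \<rho>) A2"
  have "2 * (cost \<sigma> + L2 * penalty \<sigma>) \<le> cost \<rho> + cost \<sigma> + L2 * (2 * penalty \<tau>)"
    using minimiserD[OF \<sigma> \<tau>(1)] \<tau>(2) by (simp add: field_simps)
  also have "\<dots> \<le> cost \<rho> + cost \<sigma> + L2 * (penalty \<rho> + penalty \<sigma> - 2 * gap_rate q * m)"
    using gap L by (intro add_left_mono mult_left_mono) (auto simp: m_def field_simps)
  finally have "2 * L2 * gap_rate q * m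
      \<le> (cost \<rho> + L1 * penalty \<rho>) - (cost \<sigma> + L1 * penalty \<sigma>)
        + (L2 - L1) * penalty \<rho> - (L2 - L1) * penalty \<sigma>"
    by (simp add: algebra_simps)
  also have "\<dots> \<le> (L2 - L1) * penalty \<rho>"
  proof -
    have "0 \<le> (L2 - L1) * penalty \<sigma>" using L penalty_nonneg[OF s] by simp
    with opt show ?thesis by linarith
  qed
  also note close
  finally have "m \<le> 1 - 1 / q"
    using L gap_rate_pos[OF q] by (simp add: mult.assoc)
  then obtain \<eta> where \<eta>: "admissible \<eta>" "cost \<eta> \<le> q * cost \<rho>"
    "penalty \<eta> \<le> q\<^sup>2 * penalty \<sigma> + 2 * dominance_cost (q\<^sup>2)"
    using truncated_competitor[OF r s q A _ dom] unfolding m_def by blast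
  have "cost \<sigma> + L2 * penalty \<sigma> \<le> cost \<eta> + L2 * penalty \<eta>" by (rule minimiserD[OF \<sigma> \<eta>(1)])
  also have "\<dots> \<le> q * cost \<rho> + L2 * (q\<^sup>2 * penalty \<sigma> + 2 * dominance_cost (q\<^sup>2))"
    using \<eta> L by (intro add_mono mult_left_mono) auto
  finally show ?thesis using opt by (simp add: algebra_simps)
qed

text \<open>
  Comparison with \<open>\<pi>\<close> bounds penalties and costs of all minimisers with weight above
  \<open>\<Lambda>/2\<close>, so the bound on the drop of the penalty is uniform near \<open>\<Lambda>\<close>: first choose \<open>q\<close> close to 1 to
  make its right-hand side small, then the weights so close that its hypothesis holds.
\<close>
lemma penalty_minimiser_continuous:
  assumes b: "\<And>L. 0 < L \<Longrightarrow> minimiser L (b L)"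
    and \<pi>: "admissible \<pi>" "penalty \<pi> = 0" and \<Lambda>: "0 < \<Lambda>"
  shows "isCont (\<lambda>L. penalty (b L)) \<Lambda>"
proof -
  define H where "H = cost \<pi>"
  define K where "K = 2 * H / \<Lambda>"
  have H0: "0 \<le> H" using admissibleD(5)[OF \<pi>(1)] by (simp add: H_def)
  have K0: "0 \<le> K" using H0 \<Lambda> by (simp add: K_def)
  have bound: "0 \<le> penalty (b L)" "penalty (b L) \<le> K" "cost (b L) \<le> H" if L: "\<Lambda> / 2 < L" for L
  proof -
    have L0: "0 < L" using L \<Lambda> by simp
    note a = minimiser_admissible[OF b[OF L0]]
    show p: "0 \<le> penalty (b L)" by (rule penalty_nonneg[OF a])
    have le: "cost (b L) + L * penalty (b L) \<le> H"
      using minimiserD[OF b[OF L0] \<pi>(1)] \<pi>(2) by (simp add: H_def)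
    have "0 \<le> L * penalty (b L)" using L0 p by simp
    then show "cost (b L) \<le> H" using le by linarith
    have "\<Lambda> / 2 * penalty (b L) \<le> L * penalty (b L)" using L p by (intro mult_right_mono) auto
    also have "\<dots> \<le> H" using le admissibleD(5)[OF a] by linarith
    finally show "penalty (b L) \<le> K" using \<Lambda> by (simp add: K_def field_simps)
  qed
  have "\<exists>d>0. \<forall>L. L \<noteq> \<Lambda> \<and> \<bar>L - \<Lambda>\<bar> < d \<longrightarrow> \<bar>penalty (b L) - penalty (b \<Lambda>)\<bar> < e" if e: "0 < e" for e
  proof -
    let ?F = "\<lambda>q. (q - 1) * H + 2 * \<Lambda> * ((q\<^sup>2 - 1) * K + 2 * dominance_cost (q\<^sup>2))"
    have "eventually (\<lambda>q. ?F q < \<Lambda> / 2 * e) (at_right 1)"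
      by (rule order_tendstoD(2)[OF truncation_error_tendsto_0]) (use \<Lambda> e in simp)
    moreover have "eventually (\<lambda>q::real. 1 < q) (at_right 1)" by (simp add: eventually_at_filter)
    ultimately have "eventually (\<lambda>q. ?F q < \<Lambda> / 2 * e \<and> 1 < q) (at_right 1)" by (rule eventually_conj)
    then obtain q where q: "?F q < \<Lambda> / 2 * e" "1 < q"
      using eventually_happens trivial_limit_at_right_real by blast
    have rate: "0 < gap_rate q * (1 - 1 / q)" using q gap_rate_pos by simp
    \<comment> \<open>the second term yields the hypothesis \<open>close\<close> of \<open>penalty_drop_bound\<close>;
      \<open>K + 1\<close> because \<open>K\<close> may be 0\<close>
    define d where "d = min (\<Lambda> / 2) (\<Lambda> * (gap_rate q * (1 - 1 / q)) / (K + 1))"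
    have d: "0 < d" using \<Lambda> rate K0 by (simp add: d_def)
    have drop: "0 \<le> penalty (b L1) - penalty (b L2) \<and> penalty (b L1) - penalty (b L2) < e"
      if L: "\<Lambda> / 2 < L1" "L1 < L2" "L2 < 2 * \<Lambda>" "L2 - L1 < d" for L1 L2
    proof -
      have L0: "0 < L1" "0 < L2" and L2: "\<Lambda> / 2 < L2" using L \<Lambda> by auto
      note b1 = bound[OF L(1)] and b2 = bound[OF L2]
      note m = b[OF L0(1)] b[OF L0(2)]
      have anti: "penalty (b L2) \<le> penalty (b L1)" by (rule penalty_antimono[OF L(2) m])
      have "(L2 - L1) * penalty (b L1) \<le> d * (K + 1)"
        using L b1 d K0 by (intro mult_mono) auto
      also have "\<dots> \<le> \<Lambda> * (gap_rate q * (1 - 1 / q))"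
        using K0 by (simp add: d_def min_le_iff_disj pos_le_divide_eq[symmetric])
      also have "\<dots> \<le> 2 * L2 * (gap_rate q * (1 - 1 / q))"
        using L2 rate by (intro mult_right_mono) auto
      finally have close: "(L2 - L1) * penalty (b L1) \<le> 2 * L2 * gap_rate q * (1 - 1 / q)"
        by (simp add: mult.assoc)
      have q2: "1 < q\<^sup>2" using q(2) by (simp add: one_less_power)
      have dc: "0 \<le> (q\<^sup>2 - 1) * penalty (b L2) + 2 * dominance_cost (q\<^sup>2)"
        using b2 q2 dominance_cost_nonneg[of "q\<^sup>2"] by simp
      have "\<Lambda> / 2 * (penalty (b L1) - penalty (b L2)) \<le> L1 * (penalty (b L1) - penalty (b L2))"
        using L anti by (intro mult_right_mono) auto
      also have "\<dots> \<le> (q - 1) * cost (b L1) + L2 * ((q\<^sup>2 - 1) * penalty (b L2) + 2 * dominance_cost (q\<^sup>2))"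
        by (rule penalty_drop_bound[OF L0(1) L(2) q(2) m close])
      also have "\<dots> \<le> (q - 1) * H + 2 * \<Lambda> * ((q\<^sup>2 - 1) * penalty (b L2) + 2 * dominance_cost (q\<^sup>2))"
        using b1 L q dc by (intro add_mono mult_left_mono mult_right_mono) auto
      also have "\<dots> \<le> ?F q"
        using b2 q2 \<Lambda> by (intro add_left_mono mult_left_mono add_right_mono) auto
      also note q(1)
      finally have "penalty (b L1) - penalty (b L2) < e" using \<Lambda> by simp
      with anti show ?thesis by simp
    qed
    show ?thesis
    proof (intro exI[of _ d] conjI d allI impI)
      fix L assume L: "L \<noteq> \<Lambda> \<and> \<bar>L - \<Lambda>\<bar> < d"
      moreover have "d \<le> \<Lambda> / 2" unfolding d_def by (rule min.cobounded1)
      ultimately show "\<bar>penalty (b L) - penalty (b \<Lambda>)\<bar> < e"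
        using drop[of L \<Lambda>] drop[of \<Lambda> L] \<Lambda> by (cases "L < \<Lambda>") (auto simp: abs_if field_simps split: if_splits)
    qed
  qed
  then show ?thesis unfolding isCont_def LIM_eq by simp
qed

end

section \<open>The envelope argument\<close>

text \<open>
  The value \<open>C L + L K(L)\<close> is the minimum at \<open>L\<close> of a family of affine functions.  The line of
  \<open>\<Lambda>\<close> bounds the value at \<open>L\<close> from above and the line of \<open>L\<close> bounds that at \<open>\<Lambda>\<close>, so the
  difference quotient lies between \<open>K \<Lambda>\<close> and \<open>K L\<close>.
\<close>
lemma envelope_derivative:
  fixes C K :: "real \<Rightarrow> real"
  assumes opt: "\<And>L M. 0 < L \<Longrightarrow> 0 < M \<Longrightarrow> C L + L * K L \<le> C M + L * K M"
    and "0 < \<Lambda>" and cont: "isCont K \<Lambda>"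
  shows "((\<lambda>L. C L + L * K L) has_real_derivative K \<Lambda>) (at \<Lambda>)"
proof -
  let ?E = "\<lambda>L. C L + L * K L"
  have pos: "eventually (\<lambda>L. 0 < L) (at \<Lambda>)"
    using \<open>0 < \<Lambda>\<close> by (rule order_tendstoD[OF tendsto_ident_at])
  have ne: "eventually (\<lambda>L. L \<noteq> \<Lambda>) (at \<Lambda>)" by (simp add: eventually_at_filter)
  have "((\<lambda>L. \<bar>K L - K \<Lambda>\<bar>) \<longlongrightarrow> 0) (at \<Lambda>)"
    using cont unfolding isCont_def by (rule tendsto_rabs_zero[OF LIM_zero])
  moreover have "eventually (\<lambda>L. norm ((?E L - ?E \<Lambda>) / (L - \<Lambda>) - K \<Lambda>) \<le> \<bar>K L - K \<Lambda>\<bar>) (at \<Lambda>)"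
    using pos ne
  proof eventually_elim
    case (elim L)
    then have "L \<noteq> \<Lambda>" by simp
    have "?E L - ?E \<Lambda> - (L - \<Lambda>) * K \<Lambda> \<le> 0"
      using opt[of L \<Lambda>] elim \<open>0 < \<Lambda>\<close> by (simp add: algebra_simps)
    moreover have "(L - \<Lambda>) * (K L - K \<Lambda>) \<le> ?E L - ?E \<Lambda> - (L - \<Lambda>) * K \<Lambda>"
      using opt[of \<Lambda> L] elim \<open>0 < \<Lambda>\<close> by (simp add: algebra_simps)
    ultimately have "\<bar>?E L - ?E \<Lambda> - (L - \<Lambda>) * K \<Lambda>\<bar> \<le> \<bar>(L - \<Lambda>) * (K L - K \<Lambda>)\<bar>" by linarith
    moreover have "(?E L - ?E \<Lambda>) / (L - \<Lambda>) - K \<Lambda> = (?E L - ?E \<Lambda> - (L - \<Lambda>) * K \<Lambda>) / (L - \<Lambda>)"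
      using \<open>L \<noteq> \<Lambda>\<close> by (simp add: diff_divide_distrib)
    ultimately show ?case using \<open>L \<noteq> \<Lambda>\<close> by (simp add: abs_mult divide_le_eq mult.commute)
  qed
  ultimately have "((\<lambda>L. (?E L - ?E \<Lambda>) / (L - \<Lambda>) - K \<Lambda>) \<longlongrightarrow> 0) (at \<Lambda>)"
    by (rule Lim_null_comparison[rotated])
  then show ?thesis unfolding has_field_derivative_iff by (rule LIM_zero_cancel)
qed

theorem theorem3p9:
  fixes c :: "(real ^ 'dx) \<times> (real ^ 'dy) \<Rightarrow> real"
    and \<mu> :: "(real ^ 'dx) measure" and \<nu> :: "(real ^ 'dy) measure"
  assumes "\<And>z. 0 \<le> c z"
    and "lower_semicontinuous c"
    and "\<mu> \<in> P2" and "\<nu> \<in> P2"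
    and "(\<integral>\<^sup>+y. (\<integral>\<^sup>+x. ennreal (c (x, y)) \<partial>\<mu>) \<partial>\<nu>) < \<infinity>"
    and "\<And>\<Lambda>. 0 < \<Lambda> \<Longrightarrow> \<exists>!\<rho>. is_best_response c \<mu> \<nu> \<Lambda> \<rho>"
  shows "(\<forall>\<Lambda>>0.
            (\<forall>L>0. \<bar>energy c \<mu> \<nu> (best_response c \<mu> \<nu> \<Lambda>) L\<bar> \<noteq> \<infinity>) \<and>
            (\<lambda>L. real_of_ereal (energy c \<mu> \<nu> (best_response c \<mu> \<nu> \<Lambda>) L)) differentiable (at \<Lambda>) \<and>
            (Ed c \<mu> \<nu> has_real_derivative
               partial_energy c \<mu> \<nu> (best_response c \<mu> \<nu> \<Lambda>) \<Lambda>) (at \<Lambda>)) \<and>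
         (\<forall>\<Lambda>>0. \<bar>velocity c \<mu> \<nu> \<Lambda>\<bar> \<noteq> \<infinity> \<and>
            (Ed c \<mu> \<nu> has_real_derivative real_of_ereal (velocity c \<mu> \<nu> \<Lambda>)) (at \<Lambda>)) \<and>
         (\<forall>T \<Lambda>. is_interval T \<longrightarrow>
            (solves_on (deriv (Ed c \<mu> \<nu>)) T \<Lambda> \<longleftrightarrow>
             solves_on (\<lambda>L. real_of_ereal (velocity c \<mu> \<nu> L)) T \<Lambda>))"
proof -
  interpret penalised_transport c \<mu> \<nu>
    using assms by unfold_locales (auto intro: lower_semicontinuous_measurable)
  define b where "b = best_response c \<mu> \<nu>"
  note \<pi> = product_admissible[OF assms(5)]
  have b: "minimiser L (b L)" if "0 < L" for L
    unfolding b_def best_response_def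
    by (rule is_best_response_minimiser[OF that theI'[OF assms(6)[OF that]] \<pi>(1)])
  have a: "admissible (b L)" if "0 < L" for L by (rule minimiser_admissible[OF b[OF that]])
  have energy: "energy c \<mu> \<nu> (b L) M = ereal (cost (b L) + M * penalty (b L))" if "0 < L" for L M
    by (rule energy_admissible[OF a[OF that]])
  have velocity: "velocity c \<mu> \<nu> L = ereal (penalty (b L))" if "0 < L" for L
    using admissibleD[OF a[OF that]] by (simp add: velocity_def penalty_def b_def)
  have affine: "((\<lambda>M. real_of_ereal (energy c \<mu> \<nu> (b L) M)) has_real_derivative penalty (b L)) (at L)"
    if "0 < L" for L
    unfolding energy[OF that] by (auto intro!: derivative_eq_intros)
  then have partial: "partial_energy c \<mu> \<nu> (b L) L = penalty (b L)" if "0 < L" for L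
    unfolding partial_energy_def using that by (intro DERIV_imp_deriv)
  have Ed: "(Ed c \<mu> \<nu> has_real_derivative penalty (b \<Lambda>)) (at \<Lambda>)" if \<Lambda>: "0 < \<Lambda>" for \<Lambda>
  proof -
    have "((\<lambda>L. cost (b L) + L * penalty (b L)) has_real_derivative penalty (b \<Lambda>)) (at \<Lambda>)"
      using b a \<Lambda> penalty_minimiser_continuous[OF b \<pi> \<Lambda>]
      by (intro envelope_derivative) (auto intro: minimiserD)
    moreover have "eventually (\<lambda>L. cost (b L) + L * penalty (b L) = Ed c \<mu> \<nu> L) (nhds \<Lambda>)"
      using eventually_nhds_in_open[of "{0<..}" \<Lambda>] \<Lambda>
      by (auto elim!: eventually_mono simp: Ed_def b_def[symmetric] energy)
    ultimately show ?thesis by (rule DERIV_cong_ev[OF refl _ refl, THEN iffD1, rotated])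
  qed
  have "real_of_ereal (velocity c \<mu> \<nu> L) = deriv (Ed c \<mu> \<nu>) L" if "0 < L" for L
    using DERIV_imp_deriv[OF Ed[OF that]] velocity[OF that] by simp
  then have "solves_on (deriv (Ed c \<mu> \<nu>)) T \<Lambda> \<longleftrightarrow> solves_on (\<lambda>L. real_of_ereal (velocity c \<mu> \<nu> L)) T \<Lambda>"
    for T \<Lambda>
    unfolding solves_on_def by (intro ball_cong refl conj_cong) simp
  moreover have "(\<lambda>M. real_of_ereal (energy c \<mu> \<nu> (b L) M)) differentiable (at L)" if "0 < L" for L
    using affine[OF that] by (auto simp: real_differentiable_def)
  ultimately show ?thesis
    unfolding b_def[symmetric] using Ed energy velocity partial by simp
qed

end
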